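(* Suppose $\pi$ is an admissible policy, and let $\pi'$ be a policy (i.e., a continuous function $\mathcal X\to\mathcal U$) such that $$\pi'(x)\in\arg\max_{u\in\mathcal U}h(x,u,\nabla v_\pi(x))\qquad\forall x\in\mathcal X.$$ Then $\pi'$ is also admissible and $\pi\preccurlyeq\pi'$, i.e., $v_\pi(x)\le v_{\pi'}(x)$ for all $x\in\mathcal X$.
   Context: State space $\mathcal X=\mathbb R^l$, $\mathcal X^{\mathsf T}=\mathbb R^{1\times l}$, time space $\mathbb T=[0,\infty)$. The action space $\mathcal U\subseteq\mathbb R^m$ is an $m$-dimensional manifold with or without boundary, meaning $\mathcal U=O\cup\partial O$ or $\mathcal U=O$ for some open $O\subseteq\mathbb R^m$. The environment is $\dot X_t=f(X_t,U_t)$, with $f:\mathcal X\times\mathcal U\to\mathcal X$ continuous and $t\mapsto U_t\in\mathcal U$ continuous; it is a standing assumption that the state trajectory $t\mapsto X_t$ is uniquely defined over all of $\mathbb T$ (for every initial state, in particular under every policy). A policy is a continuous function $\pi:\mathcal X\to\mathcal U$. $\mathbb G_\pi^x[Y]$ denotes the value of $Y$ when $X_0=x$ and $U_t=\pi(X_t)$ for all $t\in\mathbb T$. The reward function $r:\mathcal X\times\mathcal U\to\mathbb R$ is continuous, $R_t=r(X_t,U_t)$; $\gamma\in(0,1]$ is the discount factor and $\alpha=-\ln\gamma\ge0$. Standing assumption: $r$ attains a maximum $r_{\mathsf{max}}$, and $r_{\mathsf{max}}=0$ if $\gamma=1$. The value function (VF) of $\pi$ is $v_\pi(x)=\mathbb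 G_\pi^x[\int_0^\infty\gamma^tR_t\,dt]\in[-\infty,\infty)$. A policy $\pi$ is admissible iff $v_\pi(x)$ is finite for all $x\in\mathcal X$. Standing assumption: at least one admissible policy exists, and every admissible VF is $\mathrm C^1$. Gradients $\nabla v(x)\in\mathcal X^{\mathsf T}$ are row vectors, and the Hamiltonian is $h(x,u,p)=r(x,u)+p\,f(x,u)$. Standing assumption: there is a continuous function $u_*:\mathcal X\times\mathcal X^{\mathsf T}\to\mathcal U$ with $u_*(x,p)\in\arg\max_{u\in\mathcal U}h(x,u,p)$ for all $(x,p)$ (so such a $\pi'$ exists). *)

theory Defs
  imports "HOL-Analysis.Analysis"
begin

definition action_space :: "(real ^ 'm) set \<Rightarrow> bool" where
  "action_space U \<longleftrightarrow> (\<exists>S. open S \<and> (U = S \<union> frontier S \<or> U = S))"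

definition policy :: "(real ^ 'm) set \<Rightarrow> (real ^ 'l \<Rightarrow> real ^ 'm) \<Rightarrow> bool" where
  "policy U \<pi> \<longleftrightarrow> continuous_on UNIV \<pi> \<and> range \<pi> \<subseteq> U"

text \<open>Only the values at times \<open>t \<ge> 0\<close> of an action signal \<open>u\<close> or a state
  trajectory \<open>X\<close> are meaningful; at \<open>t = 0\<close> the derivative is one-sided.\<close>

definition trajectory ::
  "(real ^ 'l \<Rightarrow> real ^ 'm \<Rightarrow> real ^ 'l) \<Rightarrow> (real \<Rightarrow> real ^ 'm) \<Rightarrow> real ^ 'l \<Rightarrow> (real \<Rightarrow> real ^ 'l) \<Rightarrow> bool"
  where
  "trajectory f u x X \<longleftrightarrow> X 0 = x \<and>
     (\<forall>t\<ge>0. (X has_vector_derivative f (X t) (u t)) (at t within {0..}))"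

definition policy_trajectory ::
  "(real ^ 'l \<Rightarrow> real ^ 'm \<Rightarrow> real ^ 'l) \<Rightarrow> (real ^ 'l \<Rightarrow> real ^ 'm) \<Rightarrow> real ^ 'l \<Rightarrow> (real \<Rightarrow> real ^ 'l) \<Rightarrow> bool"
  where
  "policy_trajectory f \<pi> x X \<longleftrightarrow> trajectory f (\<lambda>t. \<pi> (X t)) x X"

definition unique_on_time :: "((real \<Rightarrow> 'a) \<Rightarrow> bool) \<Rightarrow> bool" where
  "unique_on_time P \<longleftrightarrow> (\<exists>X. P X \<and> (\<forall>Y. P Y \<longrightarrow> (\<forall>t\<ge>0. Y t = X t)))"

text \<open>Global existence and uniqueness are required both for exogenous continuous action
  signals and under every policy; neither requirement subsumes the other.\<close>

definition well_posed :: "(real ^ 'm) set \<Rightarrow> (real ^ 'l \<Rightarrow> real ^ 'm \<Rightarrow> real ^ 'l) \<Rightarrow> bool" where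
  "well_posed U f \<longleftrightarrow>
     (\<forall>x u. continuous_on {0..} u \<and> u ` {0..} \<subseteq> U \<longrightarrow> unique_on_time (trajectory f u x)) \<and>
     (\<forall>x \<pi>. policy U \<pi> \<longrightarrow> unique_on_time (policy_trajectory f \<pi> x))"

definition state ::
  "(real ^ 'l \<Rightarrow> real ^ 'm \<Rightarrow> real ^ 'l) \<Rightarrow> (real ^ 'l \<Rightarrow> real ^ 'm) \<Rightarrow> real ^ 'l \<Rightarrow> real \<Rightarrow> real ^ 'l"
  where
  "state f \<pi> x = (SOME X. policy_trajectory f \<pi> x X)"

text \<open>The integral over \<open>[0,\<infinity>)\<close> is the limit, in the extended reals, of the integrals over
  \<open>[0,T]\<close>. If \<open>r\<close> is bounded above by \<open>rmax\<close>, and \<open>rmax = 0\<close> in the case \<open>\<gamma> = 1\<close>, then the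
  integrand minus the integrable function \<open>\<gamma>\<^sup>t rmax\<close> is nonpositive, so that this limit
  exists and is less than \<open>\<infinity>\<close>.\<close>

definition value_fn ::
  "(real ^ 'l \<Rightarrow> real ^ 'm \<Rightarrow> real ^ 'l) \<Rightarrow> (real ^ 'l \<Rightarrow> real ^ 'm \<Rightarrow> real) \<Rightarrow> real \<Rightarrow>
   (real ^ 'l \<Rightarrow> real ^ 'm) \<Rightarrow> real ^ 'l \<Rightarrow> ereal"
  where
  "value_fn f r \<gamma> \<pi> x =
     Lim at_top (\<lambda>T::real. ereal (integral {0..T}
       (\<lambda>t. \<gamma> powr t * r (state f \<pi> x t) (\<pi> (state f \<pi> x t)))))"

definition admissible ::
  "(real ^ 'm) set \<Rightarrow> (real ^ 'l \<Rightarrow> real ^ 'm \<Rightarrow> real ^ 'l) \<Rightarrow> (real ^ 'l \<Rightarrow> real ^ 'm \<Rightarrow> real) \<Rightarrow>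
   real \<Rightarrow> (real ^ 'l \<Rightarrow> real ^ 'm) \<Rightarrow> bool"
  where
  "admissible U f r \<gamma> \<pi> \<longleftrightarrow> policy U \<pi> \<and> (\<forall>x. \<bar>value_fn f r \<gamma> \<pi> x\<bar> \<noteq> \<infinity>)"

text \<open>The real-valued value function; it agrees with \<open>value_fn\<close> for admissible \<open>\<pi>\<close>.\<close>

definition real_value_fn ::
  "(real ^ 'l \<Rightarrow> real ^ 'm \<Rightarrow> real ^ 'l) \<Rightarrow> (real ^ 'l \<Rightarrow> real ^ 'm \<Rightarrow> real) \<Rightarrow> real \<Rightarrow>
   (real ^ 'l \<Rightarrow> real ^ 'm) \<Rightarrow> real ^ 'l \<Rightarrow> real"
  where
  "real_value_fn f r \<gamma> \<pi> x = real_of_ereal (value_fn f r \<gamma> \<pi> x)"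

text \<open>Row vectors in \<open>\<real>\<^sup>1\<^sup>\<times>\<^sup>l\<close> are represented by \<open>real ^ 'l\<close>; the product of a row vector
  and a column vector is then the inner product.\<close>

definition gradient :: "(real ^ 'l \<Rightarrow> real) \<Rightarrow> real ^ 'l \<Rightarrow> real ^ 'l" where
  "gradient v x = (THE D. GDERIV v x :> D)"

definition C1 :: "(real ^ 'l \<Rightarrow> real) \<Rightarrow> bool" where
  "C1 v \<longleftrightarrow> (\<forall>x. v differentiable (at x)) \<and> continuous_on UNIV (gradient v)"

definition hamiltonian ::
  "(real ^ 'l \<Rightarrow> real ^ 'm \<Rightarrow> real ^ 'l) \<Rightarrow> (real ^ 'l \<Rightarrow> real ^ 'm \<Rightarrow> real) \<Rightarrow>
   real ^ 'l \<Rightarrow> real ^ 'm \<Rightarrow> real ^ 'l \<Rightarrow> real"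
  where
  "hamiltonian f r x u p = r x u + p \<bullet> f x u"

end

theory Submission
  imports Defs
begin

text \<open>Along its own trajectories, the value \<open>v\<close> of \<open>\<pi>\<close> satisfies the dynamic programming identity;
  differentiating it at time \<open>0\<close> gives \<open>h(x, \<pi> x, \<nabla>v x) = - ln \<gamma> * v x\<close>, so that
  \<open>h(x, \<pi>' x, \<nabla>v x) \<ge> - ln \<gamma> * v x\<close>. This says that along a trajectory \<open>Y\<close> of \<open>\<pi>'\<close> the function
  \<open>\<gamma>\<^sup>t v(Y\<^sub>t)\<close> decreases at most at the rate \<open>\<gamma>\<^sup>t R\<^sub>t\<close>. Integrating bounds the return of \<open>\<pi>'\<close> up to
  \<open>T\<close> below by \<open>v x - \<gamma>\<^sup>T v(Y\<^sub>T)\<close>, and the last term is harmless because \<open>v\<close> is bounded above,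
  by \<open>0\<close> if \<open>\<gamma> = 1\<close>.\<close>

section \<open>Gradients and exponential discounting\<close>

text \<open>A real-valued derivative is a linear functional, represented by its adjoint at
  \<open>1\<close>; the representing vector is unique, so the \<open>THE\<close> in
  \<open>gradient\<close> is well defined.\<close>

lemma gradient_works:
  assumes "v differentiable (at x)"
  shows "GDERIV v x :> gradient v x"
proof -
  obtain D where D: "(v has_derivative D) (at x)"
    using assms unfolding differentiable_def by blast
  define a where "a = adjoint D 1"
  have "D h = h \<bullet> a" for h
    unfolding a_def
    by (simp only: adjoint_works[OF has_derivative_linear[OF D]] inner_real_def mult_1_right)
  then have "D = (\<lambda>h. h \<bullet> a)" by blast
  with D have ex: "GDERIV v x :> a"
    unfolding gderiv_def by simp
  have "D1 = D2" if "GDERIV v x :> D1" "GDERIV v x :> D2" for D1 D2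
  proof -
    have "(\<lambda>h. h \<bullet> D1) = (\<lambda>h. h \<bullet> D2)"
      using that has_derivative_unique unfolding gderiv_def by blast
    then have "h \<bullet> D1 = h \<bullet> D2" for h by meson
    then show ?thesis
      by (metis vector_eq_rdot inner_commute)
  qed
  with ex show ?thesis
    unfolding gradient_def by (intro theI[where P = "\<lambda>D. GDERIV v x :> D"]) auto
qed

lemma has_real_derivative_powr_const_base:
  fixes a :: real
  assumes "0 < a"
  shows "((\<lambda>t. a powr t) has_real_derivative ln a * a powr t) (at t within S)"
proof -
  have "((\<lambda>t. exp (t * ln a)) has_real_derivative ln a * exp (t * ln a)) (at t within S)"
    by (auto intro!: derivative_eq_intros)
  then show ?thesis using assms by (simp add: powr_def)
qed

text \<open>The antiderivative is \<open>\<gamma> powr t * (b / ln \<gamma>)\<close>. For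
  \<open>\<gamma> < 1\<close> the factor \<open>- b / ln \<gamma>\<close> is the total discounted
  return of the constant reward \<open>b\<close>; for \<open>\<gamma> = 1\<close> both sides
  vanish.\<close>

lemma discounted_const_has_integral:
  fixes b \<gamma> S T :: real
  assumes "0 < \<gamma>" "\<gamma> = 1 \<longrightarrow> b = 0" "S \<le> T"
  shows "((\<lambda>t. \<gamma> powr t * b) has_integral (- b / ln \<gamma>) * (\<gamma> powr S - \<gamma> powr T)) {S..T}"
proof (cases "\<gamma> = 1")
  case False
  then have nz: "ln \<gamma> \<noteq> 0" using assms by simp
  have "((\<lambda>t. \<gamma> powr t * (b / ln \<gamma>)) has_vector_derivative \<gamma> powr t * b) (at t within {S..T})" for t
    using DERIV_cmult_right[OF has_real_derivative_powr_const_base[OF \<open>0 < \<gamma>\<close>], of "b / ln \<gamma>"] nz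
    by (simp add: has_real_derivative_iff_has_vector_derivative)
  then have "((\<lambda>t. \<gamma> powr t * b) has_integral
      (\<gamma> powr T * (b / ln \<gamma>) - \<gamma> powr S * (b / ln \<gamma>))) {S..T}"
    using assms by (intro fundamental_theorem_of_calculus) auto
  moreover have "\<gamma> powr T * (b / ln \<gamma>) - \<gamma> powr S * (b / ln \<gamma>)
      = (- b / ln \<gamma>) * (\<gamma> powr S - \<gamma> powr T)"
    by (simp add: algebra_simps)
  ultimately show ?thesis by simp
qed (use assms in auto)

text \<open>For \<open>\<gamma> < 1\<close> this is the return of the constant reward
  \<open>b\<close> from time \<open>T\<close> on. Its decay disposes of the terminal terms left by
  finite horizons.\<close>

lemma discounted_const_tendsto_0:
  fixes b \<gamma> :: real
  assumes "0 < \<gamma>" "\<gamma> \<le> 1" "\<gamma> = 1 \<longrightarrow> b = 0"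
  shows "((\<lambda>T. \<gamma> powr T * (- b / ln \<gamma>)) \<longlongrightarrow> 0) at_top"
proof (cases "\<gamma> = 1")
  case False
  have "filterlim (\<lambda>T. ln \<gamma> * T) at_bot at_top"
    using assms False by (intro filterlim_tendsto_neg_mult_at_bot[of _ "ln \<gamma>"] filterlim_ident) auto
  then have "((\<lambda>T. exp (ln \<gamma> * T)) \<longlongrightarrow> 0) at_top"
    by (rule filterlim_compose[OF exp_at_bot])
  then have "((\<lambda>T. \<gamma> powr T) \<longlongrightarrow> 0) at_top"
    using assms by (simp add: powr_def mult.commute)
  then show ?thesis by (rule tendsto_mult_left_zero)
qed (use assms in auto)

section \<open>Convergence of discounted integrals in the extended reals\<close>

lemma antimono_tendsto_INF:
  fixes A :: "real \<Rightarrow> ereal"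
  assumes "\<And>S T. 0 \<le> S \<Longrightarrow> S \<le> T \<Longrightarrow> A T \<le> A S"
  shows "(A \<longlongrightarrow> (INF T\<in>{0..}. A T)) at_top"
proof (rule decreasing_tendsto)
  show "\<forall>\<^sub>F T in at_top. (INF T\<in>{0..}. A T) \<le> A T"
    using eventually_ge_at_top[of 0] by eventually_elim (auto intro: INF_lower)
next
  fix y assume "(INF T\<in>{0..}. A T) < y"
  then obtain S where S: "0 \<le> S" "A S < y" by (auto simp: INF_less_iff)
  show "\<forall>\<^sub>F T in at_top. A T < y"
    using eventually_ge_at_top[of S]
    by eventually_elim (rule le_less_trans[OF assms[OF S(1)] S(2)])
qed

text \<open>For \<open>\<gamma> = 1\<close> the bound \<open>- b / ln \<gamma>\<close> is the intended \<open>0\<close>, since \<open>x / 0 = 0\<close>.\<close>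

lemma discounted_integral_tendsto:
  fixes g :: "real \<Rightarrow> real" and b \<gamma> :: real
  assumes g: "continuous_on {0..} g" and b: "\<And>t. 0 \<le> t \<Longrightarrow> g t \<le> b"
    and gamma: "0 < \<gamma>" "\<gamma> \<le> 1" "\<gamma> = 1 \<longrightarrow> b = 0"
  obtains L where "((\<lambda>T. ereal (integral {0..T} (\<lambda>t. \<gamma> powr t * g t))) \<longlongrightarrow> L) at_top"
    and "L \<le> ereal (- b / ln \<gamma>)"
proof -
  define C where "C = - b / ln \<gamma>"
  define J where "J T = integral {0..T} (\<lambda>t. \<gamma> powr t * g t)" for T
  \<comment> \<open>\<open>C - \<gamma> powr T * C\<close> is the integral of
    \<open>\<gamma> powr t * b\<close> over \<open>{0..T}\<close>, so \<open>A T\<close> integrates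
    the nonpositive \<open>\<gamma> powr t * (g t - b)\<close> and decreases in
    \<open>T\<close>.\<close>
  define A where "A T = J T - (C - \<gamma> powr T * C)" for T
  define L where "L = (INF T\<in>{0..}. ereal (A T))"
  have cont: "continuous_on {0..} (\<lambda>t. \<gamma> powr t * g t)"
    using gamma by (intro continuous_intros g) auto
  have int: "(\<lambda>t. \<gamma> powr t * g t) integrable_on {S..T}" if "0 \<le> S" for S T
    using that by (intro integrable_continuous_real continuous_on_subset[OF cont]) auto
  have mono: "A T \<le> A S" if "0 \<le> S" "S \<le> T" for S T
  proof -
    have "integral {S..T} (\<lambda>t. \<gamma> powr t * g t) \<le> C * (\<gamma> powr S - \<gamma> powr T)"
      unfolding C_def
    proof (rule has_integral_le[OF integrable_integral[OF int[OF that(1)]]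
          discounted_const_has_integral[OF gamma(1,3) that(2)]])
      show "\<gamma> powr t * g t \<le> \<gamma> powr t * b" if "t \<in> {S..T}" for t
        using that \<open>0 \<le> S\<close> by (intro mult_left_mono b) auto
    qed
    moreover have "J S + integral {S..T} (\<lambda>t. \<gamma> powr t * g t) = J T"
      using that int[of 0 T] unfolding J_def by (intro Henstock_Kurzweil_Integration.integral_combine) auto
    ultimately show ?thesis unfolding A_def by (simp add: algebra_simps)
  qed
  have A: "((\<lambda>T. ereal (A T)) \<longlongrightarrow> L) at_top"
    unfolding L_def by (rule antimono_tendsto_INF) (simp add: mono)
  have "((\<lambda>T. C - \<gamma> powr T * C) \<longlongrightarrow> C - 0) at_top"
    using discounted_const_tendsto_0[OF gamma] unfolding C_def by (intro tendsto_intros)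
  \<comment> \<open>Adding the subtracted part back is safe even if \<open>L\<close> is
    \<open>-\<infinity>\<close>, because \<open>C\<close> is finite.\<close>
  then have "((\<lambda>T. ereal (A T) + ereal (C - \<gamma> powr T * C)) \<longlongrightarrow> L + ereal C) at_top"
    by (intro tendsto_add_ereal_general A) auto
  then have "((\<lambda>T. ereal (J T)) \<longlongrightarrow> L + ereal C) at_top"
    by (simp add: A_def)
  moreover have "L \<le> ereal (A 0)" unfolding L_def by (intro INF_lower) auto
  then have "L + ereal C \<le> ereal C"
    using gamma add_right_mono[of L 0 "ereal C"] by (simp add: A_def J_def zero_ereal_def)
  ultimately show thesis by (intro that[of "L + ereal C"]) (simp_all only: J_def C_def)
qed

section \<open>State trajectories under a policy\<close>

lemma state_policy_trajectory:
  assumes "well_posed U f" "policy U \<pi>"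
  shows "policy_trajectory f \<pi> x (state f \<pi> x)"
  using assms unfolding well_posed_def unique_on_time_def state_def by (metis someI_ex)

lemma policy_trajectory_eq_state:
  assumes "well_posed U f" "policy U \<pi>" "policy_trajectory f \<pi> x Y" "0 \<le> t"
  shows "Y t = state f \<pi> x t"
  using assms state_policy_trajectory[OF assms(1,2), of x]
  unfolding well_posed_def unique_on_time_def by metis

lemma state_0:
  assumes "well_posed U f" "policy U \<pi>"
  shows "state f \<pi> x 0 = x"
  using state_policy_trajectory[OF assms] unfolding policy_trajectory_def trajectory_def by blast

lemma state_derivative:
  assumes "well_posed U f" "policy U \<pi>" "0 \<le> t"
  shows "(state f \<pi> x has_vector_derivative f (state f \<pi> x t) (\<pi> (state f \<pi> x t))) (at t within {0..})"
  using state_policy_trajectory[OF assms(1,2), of x] assms(3)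
  unfolding policy_trajectory_def trajectory_def by blast

text \<open>The dynamics are autonomous under a policy: a trajectory shifted by \<open>s\<close> is
  again a trajectory, now from the state at time \<open>s\<close>, and uniqueness identifies the
  two.\<close>

lemma state_add:
  assumes wp: "well_posed U f" "policy U \<pi>" and s: "0 \<le> s" and t: "0 \<le> t"
  shows "state f \<pi> (state f \<pi> x s) t = state f \<pi> x (t + s)"
proof -
  let ?X = "state f \<pi> x"
  have "((\<lambda>t. ?X (t + s)) has_vector_derivative f (?X (t + s)) (\<pi> (?X (t + s)))) (at t within {0..})"
    if "0 \<le> t" for t
  proof -
    \<comment> \<open>The chain rule asks for the derivative within the image of
      \<open>{0..}\<close> under the shift; this image lies in \<open>{0..}\<close> since
      \<open>0 \<le> s\<close>.\<close>
    have "(?X has_vector_derivative f (?X (t + s)) (\<pi> (?X (t + s))))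
        (at (t + s) within (\<lambda>t. t + s) ` {0..})"
      using that s by (intro has_vector_derivative_within_subset[OF state_derivative[OF wp]]) auto
    moreover have "((\<lambda>t. t + s) has_vector_derivative 1) (at t within {0..})"
      by (auto intro!: derivative_eq_intros simp flip: has_real_derivative_iff_has_vector_derivative)
    ultimately show ?thesis
      using vector_diff_chain_within[of "\<lambda>t. t + s" 1 t "{0..}" ?X] by (simp add: o_def)
  qed
  then have "policy_trajectory f \<pi> (?X s) (\<lambda>t. ?X (t + s))"
    unfolding policy_trajectory_def trajectory_def by simp
  from policy_trajectory_eq_state[OF wp this t] show ?thesis by simp
qed

lemma continuous_on_state:
  assumes "well_posed U f" "policy U \<pi>"
  shows "continuous_on {0..} (state f \<pi> x)"
  using has_vector_derivative_continuous[OF state_derivative[OF assms]]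
  by (simp add: continuous_on_eq_continuous_within)

lemma continuous_on_policy_state:
  assumes wp: "well_posed U f" "policy U \<pi>"
    and g: "continuous_on (UNIV \<times> U) (\<lambda>(x, u). g x u)"
  shows "continuous_on {0..} (\<lambda>t. g (state f \<pi> x t) (\<pi> (state f \<pi> x t)))"
proof -
  have "continuous_on {0..} (\<lambda>t. (state f \<pi> x t, \<pi> (state f \<pi> x t)))"
    using wp(2) unfolding policy_def
    by (intro continuous_on_Pair continuous_on_state[OF wp]
        continuous_on_compose2[OF _ continuous_on_state[OF wp]]) auto
  then have "continuous_on {0..} ((\<lambda>(x, u). g x u) \<circ> (\<lambda>t. (state f \<pi> x t, \<pi> (state f \<pi> x t))))"
    using wp(2) unfolding policy_def
    by (intro continuous_on_compose continuous_on_subset[OF g]) auto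
  then show ?thesis by (simp add: o_def)
qed

section \<open>The value function and dynamic programming\<close>

text \<open>\<open>Lim\<close> denotes an actual limit only once convergence is known; the upper
  bound on the reward provides it, with \<open>-\<infinity>\<close> still possible.\<close>

lemma value_fn_tendsto:
  assumes wp: "well_posed U f" "policy U \<pi>"
    and r: "continuous_on (UNIV \<times> U) (\<lambda>(x, u). r x u)" "\<forall>x. \<forall>u\<in>U. r x u \<le> rmax"
    and gamma: "0 < \<gamma>" "\<gamma> \<le> 1" "\<gamma> = 1 \<longrightarrow> rmax = 0"
  shows "((\<lambda>T. ereal (integral {0..T} (\<lambda>t. \<gamma> powr t * r (state f \<pi> x t) (\<pi> (state f \<pi> x t)))))
      \<longlongrightarrow> value_fn f r \<gamma> \<pi> x) at_top" (is "(?J \<longlongrightarrow> _) _")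
    and "value_fn f r \<gamma> \<pi> x \<le> ereal (- rmax / ln \<gamma>)"
proof -
  have bound: "r (state f \<pi> x t) (\<pi> (state f \<pi> x t)) \<le> rmax" for t
    using r(2) wp(2) unfolding policy_def by blast
  obtain L where L: "(?J \<longlongrightarrow> L) at_top" "L \<le> ereal (- rmax / ln \<gamma>)"
    by (rule discounted_integral_tendsto[OF continuous_on_policy_state[OF wp r(1)] bound gamma])
  have "value_fn f r \<gamma> \<pi> x = L"
    unfolding value_fn_def by (rule tendsto_Lim[OF _ L(1)]) simp
  with L show "(?J \<longlongrightarrow> value_fn f r \<gamma> \<pi> x) at_top"
    and "value_fn f r \<gamma> \<pi> x \<le> ereal (- rmax / ln \<gamma>)" by auto
qed

lemma value_fn_eq_real:
  assumes "admissible U f r \<gamma> \<pi>"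
  shows "value_fn f r \<gamma> \<pi> x = ereal (real_value_fn f r \<gamma> \<pi> x)"
  using assms unfolding admissible_def real_value_fn_def by (auto simp: ereal_real)

text \<open>Split the integral over \<open>{0..T + s}\<close> at \<open>s\<close>. By
  \<open>state_add\<close> the second piece is \<open>\<gamma> powr s\<close> times the return over
  \<open>{0..T}\<close> from the state at time \<open>s\<close>; then let \<open>T\<close> tend to
  infinity.\<close>

lemma dynamic_programming:
  assumes wp: "well_posed U f" and adm: "admissible U f r \<gamma> \<pi>"
    and r: "continuous_on (UNIV \<times> U) (\<lambda>(x, u). r x u)" "\<forall>x. \<forall>u\<in>U. r x u \<le> rmax"
    and gamma: "0 < \<gamma>" "\<gamma> \<le> 1" "\<gamma> = 1 \<longrightarrow> rmax = 0"
    and s: "0 \<le> s"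
  shows "integral {0..s} (\<lambda>t. \<gamma> powr t * r (state f \<pi> x t) (\<pi> (state f \<pi> x t)))
      + \<gamma> powr s * real_value_fn f r \<gamma> \<pi> (state f \<pi> x s) = real_value_fn f r \<gamma> \<pi> x"
proof -
  have pol: "policy U \<pi>" using adm unfolding admissible_def by blast
  define R where "R x t = \<gamma> powr t * r (state f \<pi> x t) (\<pi> (state f \<pi> x t))" for x t
  have lim: "((\<lambda>T. integral {0..T} (R x)) \<longlongrightarrow> real_value_fn f r \<gamma> \<pi> x) at_top" for x
    using value_fn_tendsto(1)[OF wp pol r gamma, of x]
    unfolding value_fn_eq_real[OF adm] R_def by simp
  have int: "R x integrable_on {0..T}" for T
    unfolding R_def using gamma
    by (intro integrable_continuous_real continuous_intros
        continuous_on_subset[OF continuous_on_policy_state[OF wp pol r(1)]]) auto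
  have eq: "integral {0..s} (R x) + \<gamma> powr s * integral {0..T} (R (state f \<pi> x s))
      = integral {0..T + s} (R x)" if "0 \<le> T" for T
  proof -
    have "\<gamma> powr s * integral {0..T} (R (state f \<pi> x s))
        = integral {0..T} (\<lambda>t. \<gamma> powr s * R (state f \<pi> x s) t)"
      by simp
    also have "\<dots> = integral {0..T} (\<lambda>t. R x (t + s))"
      using s by (intro integral_cong) (simp add: R_def state_add[OF wp pol s] powr_add mult_ac)
    also have "\<dots> = integral {s..T + s} (R x)"
      using integral_shift_real_ivl[of s s "T + s" "R x"] by simp
    finally show ?thesis
      using s that Henstock_Kurzweil_Integration.integral_combine[OF _ _ int, of s "T + s"] by simp
  qed
  have "((\<lambda>T. integral {0..s} (R x) + \<gamma> powr s * integral {0..T} (R (state f \<pi> x s)))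
      \<longlongrightarrow> integral {0..s} (R x) + \<gamma> powr s * real_value_fn f r \<gamma> \<pi> (state f \<pi> x s)) at_top"
    by (intro tendsto_intros lim)
  moreover have "((\<lambda>T. integral {0..T + s} (R x)) \<longlongrightarrow> real_value_fn f r \<gamma> \<pi> x) at_top"
    using filterlim_tendsto_add_at_top[OF tendsto_const[of s] filterlim_ident]
    by (intro filterlim_compose[OF lim]) (simp add: add.commute)
  then have "((\<lambda>T. integral {0..s} (R x) + \<gamma> powr s * integral {0..T} (R (state f \<pi> x s)))
      \<longlongrightarrow> real_value_fn f r \<gamma> \<pi> x) at_top"
    by (rule Lim_transform_eventually)
      (use eventually_ge_at_top[of 0] in \<open>eventually_elim, simp add: eq\<close>)
  ultimately show ?thesis
    unfolding R_def[symmetric] using tendsto_unique[OF trivial_limit_at_top_linorder] by blast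
qed

section \<open>Differentiation along trajectories and the Hamiltonian\<close>

lemma discounted_value_derivative:
  assumes wp: "well_posed U f" "policy U \<pi>" and v: "v differentiable (at (state f \<pi> x t))"
    and "0 < \<gamma>" "0 \<le> t"
  shows "((\<lambda>t. \<gamma> powr t * v (state f \<pi> x t)) has_vector_derivative
      \<gamma> powr t * (ln \<gamma> * v (state f \<pi> x t)
        + gradient v (state f \<pi> x t) \<bullet> f (state f \<pi> x t) (\<pi> (state f \<pi> x t))))
      (at t within {0..})"
proof -
  let ?X = "state f \<pi> x"
  have "((v \<circ> ?X) has_vector_derivative f (?X t) (\<pi> (?X t)) \<bullet> gradient v (?X t)) (at t within {0..})"
    using gradient_works[OF v] unfolding gderiv_def
    by (intro vector_derivative_diff_chain_within[OF state_derivative[OF wp \<open>0 \<le> t\<close>]])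
      (rule has_derivative_at_withinI)
  then have "((\<lambda>t. v (?X t)) has_real_derivative gradient v (?X t) \<bullet> f (?X t) (\<pi> (?X t)))
      (at t within {0..})"
    by (simp add: o_def inner_commute has_real_derivative_iff_has_vector_derivative)
  then show ?thesis
    unfolding has_real_derivative_iff_has_vector_derivative[symmetric] using \<open>0 < \<gamma>\<close>
    by (auto intro!: derivative_eq_intros has_real_derivative_powr_const_base simp: algebra_simps)
qed

lemma hamiltonian_value_fn:
  assumes wp: "well_posed U f" and adm: "admissible U f r \<gamma> \<pi>"
    and r: "continuous_on (UNIV \<times> U) (\<lambda>(x, u). r x u)" "\<forall>x. \<forall>u\<in>U. r x u \<le> rmax"
    and gamma: "0 < \<gamma>" "\<gamma> \<le> 1" "\<gamma> = 1 \<longrightarrow> rmax = 0"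
    and diff: "real_value_fn f r \<gamma> \<pi> differentiable (at x)"
  shows "hamiltonian f r x (\<pi> x) (gradient (real_value_fn f r \<gamma> \<pi>) x)
      = - ln \<gamma> * real_value_fn f r \<gamma> \<pi> x"
proof -
  let ?v = "real_value_fn f r \<gamma> \<pi>" and ?X = "state f \<pi> x"
  define R where "R t = \<gamma> powr t * r (?X t) (\<pi> (?X t))" for t
  have pol: "policy U \<pi>" using adm unfolding admissible_def by blast
  have X0: "?X 0 = x" by (rule state_0[OF wp pol])
  have "continuous_on {0..1} R"
    unfolding R_def using gamma
    by (intro continuous_intros continuous_on_subset[OF continuous_on_policy_state[OF wp pol r(1)]]) auto
  \<comment> \<open>Derivatives at \<open>0\<close> are taken within \<open>{0..1}\<close>:
    trajectories matter only for nonnegative times, and one-sided derivatives on a nondegenerate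
    closed interval are unique.\<close>
  then have "((\<lambda>s. integral {0..s} R) has_vector_derivative R 0) (at 0 within {0..1})"
    by (rule integral_has_vector_derivative) simp
  moreover have "((\<lambda>t. \<gamma> powr t * ?v (?X t)) has_vector_derivative
      ln \<gamma> * ?v x + gradient ?v x \<bullet> f x (\<pi> x)) (at 0 within {0..1})"
    using discounted_value_derivative[OF wp pol, of ?v x 0 \<gamma>] diff gamma
    by (intro has_vector_derivative_within_subset[where T = "{0..1}" and S = "{0..}"]) (auto simp: X0)
  ultimately have "((\<lambda>s. integral {0..s} R + \<gamma> powr s * ?v (?X s)) has_vector_derivative
      R 0 + (ln \<gamma> * ?v x + gradient ?v x \<bullet> f x (\<pi> x))) (at 0 within {0..1})"
    by (rule has_vector_derivative_add)
  \<comment> \<open>By dynamic programming the sum is constant in \<open>s\<close>, so its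
    derivative must be zero.\<close>
  then have "((\<lambda>s. ?v x) has_vector_derivative
      R 0 + (ln \<gamma> * ?v x + gradient ?v x \<bullet> f x (\<pi> x))) (at 0 within {0..1})"
    by (rule has_vector_derivative_transform[rotated 2])
      (simp_all add: R_def[abs_def] dynamic_programming[OF wp adm r gamma])
  moreover have "((\<lambda>s. ?v x) has_vector_derivative 0) (at 0 within {0..1})"
    by (rule has_vector_derivative_const)
  ultimately have "R 0 + (ln \<gamma> * ?v x + gradient ?v x \<bullet> f x (\<pi> x)) = 0"
    using vector_derivative_unique_within_closed_interval[of 0 1 0 "\<lambda>s. ?v x"] by (simp add: cbox_interval)
  then show ?thesis
    using gamma unfolding hamiltonian_def R_def X0 by simp
qed

section \<open>Policy improvement by maximizing the Hamiltonian\<close>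

theorem theorem2p7:
  fixes U :: "(real ^ 'm) set"
    and f :: "real ^ 'l \<Rightarrow> real ^ 'm \<Rightarrow> real ^ 'l"
    and r :: "real ^ 'l \<Rightarrow> real ^ 'm \<Rightarrow> real"
    and \<gamma> rmax :: real
    and \<pi> \<pi>' :: "real ^ 'l \<Rightarrow> real ^ 'm"
  assumes U: "action_space U"
    and f_cont: "continuous_on (UNIV \<times> U) (\<lambda>(x, u). f x u)"
    and f_well_posed: "well_posed U f"
    and r_cont: "continuous_on (UNIV \<times> U) (\<lambda>(x, u). r x u)"
    and gamma: "0 < \<gamma>" "\<gamma> \<le> 1"
    and r_attains: "\<exists>x. \<exists>u\<in>U. r x u = rmax"
    and r_max: "\<forall>x. \<forall>u\<in>U. r x u \<le> rmax"
    and r_max_0: "\<gamma> = 1 \<longrightarrow> rmax = 0"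
    and ex_admissible: "\<exists>\<mu>. admissible U f r \<gamma> \<mu>"
    and vf_C1: "\<forall>\<mu>. admissible U f r \<gamma> \<mu> \<longrightarrow> C1 (real_value_fn f r \<gamma> \<mu>)"
    and ex_argmax: "\<exists>ustar. continuous_on UNIV (\<lambda>(x, p). ustar x p) \<and>
          (\<forall>x p. is_arg_max (\<lambda>u. hamiltonian f r x u p) (\<lambda>u. u \<in> U) (ustar x p))"
    and pi: "admissible U f r \<gamma> \<pi>"
    and pi': "policy U \<pi>'"
    and pi'_argmax: "\<forall>x. is_arg_max (\<lambda>u. hamiltonian f r x u (gradient (real_value_fn f r \<gamma> \<pi>) x))
          (\<lambda>u. u \<in> U) (\<pi>' x)"
  shows "admissible U f r \<gamma> \<pi>' \<and> (\<forall>x. value_fn f r \<gamma> \<pi> x \<le> value_fn f r \<gamma> \<pi>' x)"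
proof -
  let ?v = "real_value_fn f r \<gamma> \<pi>" and ?X = "state f \<pi>'"
  note gam = gamma r_max_0 and wp = f_well_posed
  have pol: "policy U \<pi>" using pi unfolding admissible_def by blast
  have C1: "C1 ?v" using vf_C1 pi by blast
  then have diff: "?v differentiable (at y)" for y unfolding C1_def by blast
  have v_le: "?v y \<le> - rmax / ln \<gamma>" for y
    using value_fn_tendsto(2)[OF wp pol r_cont r_max gam, of y] value_fn_eq_real[OF pi, of y] by simp
  \<comment> \<open>\<open>\<pi> y\<close> competes in the maximization solved by
    \<open>\<pi>' y\<close>, and its Hamiltonian is known exactly.\<close>
  have improve: "- ln \<gamma> * ?v y \<le> r y (\<pi>' y) + gradient ?v y \<bullet> f y (\<pi>' y)" for y
  proof -
    have "\<pi> y \<in> U" using pol unfolding policy_def by auto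
    then have "hamiltonian f r y (\<pi> y) (gradient ?v y) \<le> hamiltonian f r y (\<pi>' y) (gradient ?v y)"
      using pi'_argmax unfolding is_arg_max_linorder by blast
    then show ?thesis
      unfolding hamiltonian_value_fn[OF wp pi r_cont r_max gam diff] by (simp add: hamiltonian_def)
  qed
  have finite_horizon: "?v x - \<gamma> powr T * (- rmax / ln \<gamma>)
      \<le> integral {0..T} (\<lambda>t. \<gamma> powr t * r (?X x t) (\<pi>' (?X x t)))" if T: "0 \<le> T" for x T
  proof -
    let ?Y = "?X x"
    \<comment> \<open>The derivative of the discounted value of \<open>\<pi>\<close> along a
      trajectory driven by \<open>\<pi>'\<close>.\<close>
    let ?D = "\<lambda>t. \<gamma> powr t * (ln \<gamma> * ?v (?Y t) + gradient ?v (?Y t) \<bullet> f (?Y t) (\<pi>' (?Y t)))"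
    have D: "(?D has_integral \<gamma> powr T * ?v (?Y T) - \<gamma> powr 0 * ?v (?Y 0)) {0..T}"
      using T by (intro fundamental_theorem_of_calculus
          has_vector_derivative_within_subset[OF discounted_value_derivative[OF wp pi' diff gamma(1)]]) auto
    have "(\<lambda>t. \<gamma> powr t * r (?Y t) (\<pi>' (?Y t))) integrable_on {0..T}"
      using gamma by (intro integrable_continuous_real continuous_intros
          continuous_on_subset[OF continuous_on_policy_state[OF wp pi' r_cont]]) auto
    then have R: "((\<lambda>t. - (\<gamma> powr t * r (?Y t) (\<pi>' (?Y t)))) has_integral
        - integral {0..T} (\<lambda>t. \<gamma> powr t * r (?Y t) (\<pi>' (?Y t)))) {0..T}"
      by (intro has_integral_neg integrable_integral)
    have le_D: "- (\<gamma> powr t * r (?Y t) (\<pi>' (?Y t))) \<le> ?D t" for t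
    proof -
      have "\<gamma> powr t * - r (?Y t) (\<pi>' (?Y t)) \<le> ?D t"
        using improve[of "?Y t"] by (intro mult_left_mono) auto
      then show ?thesis by simp
    qed
    have "- integral {0..T} (\<lambda>t. \<gamma> powr t * r (?Y t) (\<pi>' (?Y t)))
        \<le> \<gamma> powr T * ?v (?Y T) - \<gamma> powr 0 * ?v (?Y 0)"
      by (rule has_integral_le[OF R D le_D])
    \<comment> \<open>The terminal value enters the lower bound on the return with a minus sign, so
      the uniform upper bound \<open>v_le\<close> controls it wherever the trajectory goes.\<close>
    moreover have "\<gamma> powr T * ?v (?Y T) \<le> \<gamma> powr T * (- rmax / ln \<gamma>)"
      by (intro mult_left_mono v_le) simp
    ultimately show ?thesis using gamma by (simp add: state_0[OF wp pi'])
  qed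
  \<comment> \<open>The limit is taken in \<open>ereal\<close>, since the value of
    \<open>\<pi>'\<close> is not yet known to be finite; this bound is what excludes
    \<open>-\<infinity>\<close>.\<close>
  have le: "ereal (?v x) \<le> value_fn f r \<gamma> \<pi>' x" for x
  proof (rule tendsto_le[OF trivial_limit_at_top_linorder])
    show "((\<lambda>T. ereal (integral {0..T} (\<lambda>t. \<gamma> powr t * r (?X x t) (\<pi>' (?X x t)))))
        \<longlongrightarrow> value_fn f r \<gamma> \<pi>' x) at_top"
      by (rule value_fn_tendsto(1)[OF wp pi' r_cont r_max gam])
    have "((\<lambda>T. ?v x - \<gamma> powr T * (- rmax / ln \<gamma>)) \<longlongrightarrow> ?v x - 0) at_top"
      by (intro tendsto_diff tendsto_const discounted_const_tendsto_0[OF gam])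
    then show "((\<lambda>T. ereal (?v x - \<gamma> powr T * (- rmax / ln \<gamma>))) \<longlongrightarrow> ereal (?v x)) at_top"
      by simp
    show "\<forall>\<^sub>F T in at_top. ereal (?v x - \<gamma> powr T * (- rmax / ln \<gamma>))
        \<le> ereal (integral {0..T} (\<lambda>t. \<gamma> powr t * r (?X x t) (\<pi>' (?X x t))))"
      using eventually_ge_at_top[of 0] by eventually_elim (unfold ereal_less_eq, rule finite_horizon)
  qed
  moreover have "\<bar>value_fn f r \<gamma> \<pi>' x\<bar> \<noteq> \<infinity>" for x
    using le[of x] value_fn_tendsto(2)[OF wp pi' r_cont r_max gam, of x]
    by (cases "value_fn f r \<gamma> \<pi>' x") auto
  ultimately show ?thesis
    using pi' unfolding admissible_def value_fn_eq_real[OF pi] by blast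
qed

end
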